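(* The Maximum $2$-Transitivity Problem can be solved in linear time for split graphs; that is, there is an algorithm running in linear time that, given a split graph $G$, solves the problem of finding a $2$-transitive partition of $G$ with the maximum number of parts, the maximum number of parts being $Tr_2(G)$.
   Context: Graphs are finite, simple and undirected. For disjoint $A,B\subseteq V$, $A$ $2$-dominates $B$ if every vertex of $B$ is adjacent to at least two vertices of $A$. A $2$-transitive partition of size $k$ of $G=(V,E)$ is a partition $\{V_1,\ldots,V_k\}$ of $V$ into $k$ nonempty (ordered) parts such that $V_i$ $2$-dominates $V_j$ for all $1\leq i<j\leq k$. The $2$-transitivity $Tr_2(G)$ is the maximum size of a $2$-transitive partition of $G$. The Maximum $2$-Transitivity Problem is: given a graph $G$, find a $2$-transitive partition of $G$ of maximum order. A graph $G=(V,E)$ is a split graph if $V$ can be partitioned into an independent set $S$ and a clique $K$. Linear time means $O(|V|+|E|)$. *)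

theory Defs
  imports Complex_Main "HOL-Library.Disjoint_Sets"
begin

section \<open>Graphs and 2-transitive partitions\<close>

definition simple_graph :: "'a set \<Rightarrow> 'a set set \<Rightarrow> bool" where
  "simple_graph V E \<longleftrightarrow> finite V \<and> (\<forall>e\<in>E. e \<subseteq> V \<and> card e = 2)"

definition independent_set :: "'a set set \<Rightarrow> 'a set \<Rightarrow> bool" where
  "independent_set E S \<longleftrightarrow> (\<forall>u\<in>S. \<forall>v\<in>S. {u, v} \<notin> E)"

definition clique :: "'a set set \<Rightarrow> 'a set \<Rightarrow> bool" where
  "clique E K \<longleftrightarrow> (\<forall>u\<in>K. \<forall>v\<in>K. u \<noteq> v \<longrightarrow> {u, v} \<in> E)"

text \<open>As usual for split graphs, either side of the split partition may be empty.\<close>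

definition split_graph :: "'a set \<Rightarrow> 'a set set \<Rightarrow> bool" where
  "split_graph V E \<longleftrightarrow> simple_graph V E \<and>
     (\<exists>S K. S \<union> K = V \<and> S \<inter> K = {} \<and> independent_set E S \<and> clique E K)"

definition two_dominates :: "'a set set \<Rightarrow> 'a set \<Rightarrow> 'a set \<Rightarrow> bool" where
  "two_dominates E A B \<longleftrightarrow> (\<forall>b\<in>B. card {a \<in> A. {a, b} \<in> E} \<ge> 2)"

text \<open>The list \<open>Ps\<close> is the ordered sequence of parts. Nonemptiness of the parts is included
  in \<^const>\<open>partition_on\<close>.\<close>

definition two_transitive_partition :: "'a set \<Rightarrow> 'a set set \<Rightarrow> 'a set list \<Rightarrow> bool" where
  "two_transitive_partition V E Ps \<longleftrightarrow>
     distinct Ps \<and> partition_on V (set Ps) \<and>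
     (\<forall>i j. i < j \<and> j < length Ps \<longrightarrow> two_dominates E (Ps ! i) (Ps ! j))"

definition Tr2 :: "'a set \<Rightarrow> 'a set set \<Rightarrow> nat" where
  "Tr2 V E = Max {length Ps | Ps. two_transitive_partition V E Ps}"

lemma two_transitive_sizes:
  assumes "finite V"
  shows "finite {length Ps | Ps. two_transitive_partition V E Ps}"
    and "{length Ps | Ps. two_transitive_partition V E Ps} \<noteq> {}"
proof -
  have "length Ps \<le> card V" if "two_transitive_partition V E Ps" for Ps
  proof -
    have d: "distinct Ps" and p: "partition_on V (set Ps)"
      using that by (auto simp: two_transitive_partition_def)
    have fin: "finite P" if "P \<in> set Ps" for P
    proof (rule finite_subset)
      show "P \<subseteq> V" using p that by (auto simp: partition_on_def)
    qed fact
    have "length Ps = (\<Sum>P\<in>set Ps. 1)"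
      using d by (simp add: distinct_card)
    also have "\<dots> \<le> (\<Sum>P\<in>set Ps. card P)"
    proof (rule sum_mono)
      fix P assume "P \<in> set Ps"
      then have "finite P" "P \<noteq> {}"
        using fin p by (auto simp: partition_on_def)
      then show "1 \<le> card P"
        by (simp add: Suc_leI card_gt_0_iff)
    qed
    also have "\<dots> = card (\<Union>(set Ps))"
      using p fin by (intro card_Union_disjoint[symmetric])
        (simp_all add: partition_on_def disjoint_def pairwise_def disjnt_def)
    finally show ?thesis
      using p by (simp add: partition_on_def)
  qed
  then have "{length Ps | Ps. two_transitive_partition V E Ps} \<subseteq> {..card V}"
    by auto
  then show "finite {length Ps | Ps. two_transitive_partition V E Ps}"
    by (rule finite_subset) simp
  have "two_transitive_partition V E (if V = {} then [] else [V])"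
    by (auto simp: two_transitive_partition_def partition_on_def disjoint_def)
  then show "{length Ps | Ps. two_transitive_partition V E Ps} \<noteq> {}"
    by blast
qed

lemma Tr2_attained:
  assumes "finite V"
  shows "\<exists>Ps. two_transitive_partition V E Ps \<and> length Ps = Tr2 V E"
proof -
  have "Tr2 V E \<in> {length Ps | Ps. two_transitive_partition V E Ps}"
    unfolding Tr2_def using two_transitive_sizes[OF assms] by (rule Max_in)
  then show ?thesis by force
qed

lemma Tr2_upper:
  assumes "finite V" and "two_transitive_partition V E Ps"
  shows "length Ps \<le> Tr2 V E"
  unfolding Tr2_def
proof (rule Max_ge)
  show "length Ps \<in> {length Ps | Ps. two_transitive_partition V E Ps}"
    using assms(2) by blast
qed (rule two_transitive_sizes(1)[OF assms(1)])


section \<open>A word RAM\<close>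

text \<open>
  Programs are structured; they operate on registers and on arrays of machine words, both named
  by natural numbers. Every assignment, array write and test costs one time unit.

  The parameter \<open>w\<close> of the execution relation bounds the machine words: a program that attempts
  to compute a value \<open>\<ge> w\<close> is stuck and has no execution. This justifies the unit cost of addition
  and subtraction, provided that \<open>w\<close> is polynomial in the size of the input, so that words have
  logarithmic length.
\<close>

datatype expr =
    Const nat
  | Reg nat
  | Plus nat nat      \<comment> \<open>sum of two registers\<close>
  | Minus nat nat     \<comment> \<open>truncated difference of two registers\<close>
  | Read nat nat      \<comment> \<open>array, register holding the index\<close>

datatype test =
    Less nat nat
  | Equal nat nat

datatype com =
    Skip
  | Assign nat expr
  | Write nat nat nat     \<comment> \<open>array, register holding the index, register holding the value\<close>
  | Seq com com
  | Cond test com com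
  | While test com

record state =
  regs :: "nat \<Rightarrow> nat"
  arrs :: "nat \<Rightarrow> nat \<Rightarrow> nat"

fun expr_val :: "expr \<Rightarrow> state \<Rightarrow> nat" where
  "expr_val (Const k) s = k"
| "expr_val (Reg x) s = regs s x"
| "expr_val (Plus x y) s = regs s x + regs s y"
| "expr_val (Minus x y) s = regs s x - regs s y"
| "expr_val (Read a x) s = arrs s a (regs s x)"

fun test_val :: "test \<Rightarrow> state \<Rightarrow> bool" where
  "test_val (Less x y) s \<longleftrightarrow> regs s x < regs s y"
| "test_val (Equal x y) s \<longleftrightarrow> regs s x = regs s y"

text \<open>\<open>exec w p s t s'\<close>: started in state \<open>s\<close>, the program \<open>p\<close> halts in state \<open>s'\<close> after
  exactly \<open>t\<close> time units.\<close>

inductive exec :: "nat \<Rightarrow> com \<Rightarrow> state \<Rightarrow> nat \<Rightarrow> state \<Rightarrow> bool" for w :: nat where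
  exec_Skip: "exec w Skip s 1 s"
| exec_Assign: "expr_val e s < w \<Longrightarrow>
    exec w (Assign x e) s 1 (s\<lparr>regs := (regs s)(x := expr_val e s)\<rparr>)"
| exec_Write:
    "exec w (Write a x y) s 1
       (s\<lparr>arrs := (arrs s)(a := (arrs s a)(regs s x := regs s y))\<rparr>)"
| exec_Seq: "exec w c1 s1 t1 s2 \<Longrightarrow> exec w c2 s2 t2 s3 \<Longrightarrow>
    exec w (Seq c1 c2) s1 (t1 + t2) s3"
| exec_Cond_True: "test_val b s \<Longrightarrow> exec w c1 s t s' \<Longrightarrow> exec w (Cond b c1 c2) s (1 + t) s'"
| exec_Cond_False: "\<not> test_val b s \<Longrightarrow> exec w c2 s t s' \<Longrightarrow> exec w (Cond b c1 c2) s (1 + t) s'"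
| exec_While_False: "\<not> test_val b s \<Longrightarrow> exec w (While b c) s 1 s"
| exec_While_True: "test_val b s1 \<Longrightarrow> exec w c s1 t1 s2 \<Longrightarrow> exec w (While b c) s2 t2 s3 \<Longrightarrow>
    exec w (While b c) s1 (1 + t1 + t2) s3"

inductive_cases SkipE: "exec w Skip s t s'"
inductive_cases AssignE: "exec w (Assign x e) s t s'"
inductive_cases WriteE: "exec w (Write a x y) s t s'"
inductive_cases SeqE: "exec w (Seq c1 c2) s t s'"
inductive_cases CondE: "exec w (Cond b c1 c2) s t s'"
inductive_cases WhileE: "exec w (While b c) s t s'"

text \<open>Executions are unique, so the existence of an execution with certain properties is a
  statement about the run of the program.\<close>

lemma exec_deterministic:
  "exec w c s t s' \<Longrightarrow> exec w c s u s'' \<Longrightarrow> u = t \<and> s'' = s'"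
proof (induction arbitrary: u s'' rule: exec.induct)
  case (exec_Skip s)
  then show ?case by (rule SkipE) simp
next
  case (exec_Assign e s x)
  from exec_Assign.prems show ?case by (rule AssignE) simp
next
  case (exec_Write a x y s)
  then show ?case by (rule WriteE) simp
next
  case (exec_Seq c1 s1 t1 s2 c2 t2 s3)
  from exec_Seq.prems obtain v1 v2 r
    where "u = v1 + v2" "exec w c1 s1 v1 r" "exec w c2 r v2 s''"
    by (rule SeqE)
  with exec_Seq.IH(1)[of v1 r] exec_Seq.IH(2)[of v2 s''] show ?case by simp
next
  case (exec_Cond_True b s c1 t s' c2)
  from exec_Cond_True.prems exec_Cond_True.hyps obtain v
    where "u = 1 + v" "exec w c1 s v s''"
    by (elim CondE) simp_all
  with exec_Cond_True.IH[of v s''] show ?case by simp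
next
  case (exec_Cond_False b s c2 t s' c1)
  from exec_Cond_False.prems exec_Cond_False.hyps obtain v
    where "u = 1 + v" "exec w c2 s v s''"
    by (elim CondE) simp_all
  with exec_Cond_False.IH[of v s''] show ?case by simp
next
  case (exec_While_False b s c)
  from exec_While_False.prems show ?case
    by (rule WhileE) (use exec_While_False.hyps in simp_all)
next
  case (exec_While_True b s1 c t1 s2 t2 s3)
  from exec_While_True.prems obtain v1 v2 r
    where "u = 1 + v1 + v2" "exec w c s1 v1 r" "exec w (While b c) r v2 s''"
    by (rule WhileE) (use exec_While_True.hyps in simp_all)
  with exec_While_True.IH(1)[of v1 r] exec_While_True.IH(2)[of v2 s''] show ?case by simp
qed


section \<open>Input and output of graph algorithms\<close>

text \<open>Input graphs have the vertices \<open>0, \<dots>, n - 1\<close> and are given by adjacency lists, in which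
  the neighbours of a vertex occur in arbitrary order.\<close>

definition adjacency_lists :: "nat list list \<Rightarrow> nat set \<Rightarrow> nat set set \<Rightarrow> bool" where
  "adjacency_lists adj V E \<longleftrightarrow>
     V = {..<length adj} \<and>
     (\<forall>v<length adj. distinct (adj ! v) \<and> set (adj ! v) = {u. {u, v} \<in> E})"

text \<open>
  Register \<open>0\<close> holds the number of vertices, array \<open>1\<close> the concatenation of the adjacency lists,
  and array \<open>0\<close> the offsets: the adjacency list of \<open>v\<close> occupies the positions
  from \<open>arrs s 0 v\<close> (inclusive) to \<open>arrs s 0 (v + 1)\<close> (exclusive) of array \<open>1\<close>.
  Everything else is zero; in particular, a split partition is not part of the input.
\<close>

definition input_state :: "nat list list \<Rightarrow> state" where
  "input_state adj = \<lparr>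
     regs = (\<lambda>_. 0)(0 := length adj),
     arrs = (\<lambda>_ _. 0)(
       0 := (\<lambda>i. if i \<le> length adj then sum_list (map length (take i adj)) else 0),
       1 := (\<lambda>i. if i < length (concat adj) then concat adj ! i else 0))\<rparr>"

text \<open>Register \<open>0\<close> holds the number of parts, and array \<open>2\<close> maps each vertex to the index of its
  part, where indices start with \<open>0\<close>.\<close>

definition output_parts :: "nat set \<Rightarrow> state \<Rightarrow> nat set list" where
  "output_parts V s = map (\<lambda>i. {v \<in> V. arrs s 2 v = i}) [0..<regs s 0]"

end

theory Submission
  imports Defs
begin

text \<open>
  Let \<open>f t\<close> be the number of vertices of degree at least \<open>t\<close>, and let \<open>t\<close> be the largest number with
  \<open>t \<le> f t + 1\<close>. For a nonempty split graph, \<open>Tr\<^sub>2 = \<lfloor>t / 2\<rfloor> + 1\<close>, and the vertices of degree at least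
  \<open>t\<close> are the clique side of a split partition. So both the value and an optimal partition can be
  read off from the degrees alone, which the offsets of the adjacency lists provide in constant time
  per vertex; no edge has to be inspected.

  \<^emph>\<open>Upper bound\<close> (\<open>many_high_degrees\<close>). A vertex on the independent side has all its neighbours in
  the clique, so every part before the last part that meets the independent side contains at least
  two vertices of the clique, and all later parts are contained in it. Counting the vertices of high
  degree part by part shows that \<open>k = m + 1\<close> parts force at least \<open>2 m - 1\<close> vertices of degree at
  least \<open>2 m\<close>, whence \<open>2 m \<le> t\<close>.

  \<^emph>\<open>The clique\<close> (\<open>split_partition_high_degree\<close>). Take a split partition whose clique \<open>K\<close> is as large
  as possible. Then no vertex outside \<open>K\<close> is adjacent to all of \<open>K\<close>, so the degrees separate the two
  sides up to ties at \<open>|K| - 1\<close>. The definition of \<open>t\<close> settles the ties: the set \<open>D\<close> of vertices of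
  degree at least \<open>t\<close> is \<open>K\<close>, or \<open>K\<close> without one vertex that has no neighbour outside \<open>K\<close>. Moreover
  \<open>|D|\<close> is \<open>t - 1\<close>, \<open>t\<close> or \<open>t + 1\<close>.

  \<^emph>\<open>Lower bound\<close> (\<open>two_transitive_partition_by_pairs\<close>). Number the vertices of \<open>D\<close> from
  \<open>r = t + 1 - |D|\<close> to \<open>t\<close>, put the vertex with number \<open>j\<close> into part \<open>\<lfloor>j / 2\<rfloor>\<close> and all other vertices
  into part \<open>0\<close>. All parts except the first and perhaps the last contain two vertices of the clique.
  If there is a second part, the first one contains \<open>2 - r\<close> of them, and the degree condition provides
  each vertex of \<open>D\<close> with at least \<open>r\<close> neighbours outside \<open>D\<close>, which makes up for the missing ones.

  The program tallies the degrees, lowers a candidate for \<open>t\<close> from \<open>n\<close> while it updates \<open>f t\<close>, and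
  numbers the vertices of \<open>D\<close> in one pass. It has no division: it keeps the pair of
  \<open>\<lfloor>j / 2\<rfloor>\<close> and \<open>\<lceil>j / 2\<rceil>\<close>, which \<open>(x, y) \<mapsto> (y, x + 1)\<close> takes to the pair for \<open>j + 1\<close>.
\<close>

section \<open>Degrees and split partitions\<close>

definition degree :: "'a set set \<Rightarrow> 'a \<Rightarrow> nat" where
  "degree E v = card {u. {u, v} \<in> E}"

definition high_degree :: "'a set \<Rightarrow> 'a set set \<Rightarrow> nat \<Rightarrow> 'a set" where
  "high_degree V E t = {v \<in> V. t \<le> degree E v}"

text \<open>The condition is stated as a predicate rather than a maximum, because this is the form in
  which a search from above establishes it.\<close>

definition degree_threshold :: "'a set \<Rightarrow> 'a set set \<Rightarrow> nat \<Rightarrow> bool" where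
  "degree_threshold V E t \<longleftrightarrow>
     t \<le> Suc (card (high_degree V E t)) \<and> (\<forall>u>t. Suc (card (high_degree V E u)) < u)"

locale split_partition =
  fixes V :: "'a set" and E :: "'a set set" and S K :: "'a set"
  assumes simple: "simple_graph V E"
    and cover: "S \<union> K = V" and disjoint: "S \<inter> K = {}"
    and independent: "independent_set E S" and clique: "clique E K"
begin

lemma finite_vertices: "finite V" "finite S" "finite K"
  using simple cover by (auto simp: simple_graph_def)

lemma edgeD:
  assumes "{u, v} \<in> E"
  shows "u \<in> V" "v \<in> V" "u \<noteq> v"
proof -
  have "{u, v} \<subseteq> V" "card {u, v} = 2"
    using assms simple by (auto simp: simple_graph_def)
  then show "u \<in> V" "v \<in> V" "u \<noteq> v" by auto
qed

lemma degree_in_clique: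
  assumes "u \<in> K"
  shows "Suc (degree E u) = card K + card {s \<in> S. {s, u} \<in> E}"
proof -
  have "{v. {v, u} \<in> E} = (K - {u}) \<union> {s \<in> S. {s, u} \<in> E}"
  proof (rule set_eqI)
    fix v
    show "v \<in> {v. {v, u} \<in> E} \<longleftrightarrow> v \<in> (K - {u}) \<union> {s \<in> S. {s, u} \<in> E}"
      using assms cover clique[unfolded clique_def] edgeD[of v u] by blast
  qed
  then have "degree E u = card (K - {u}) + card {s \<in> S. {s, u} \<in> E}"
    unfolding degree_def
    using disjoint finite_vertices by (subst card_Un_disjoint[symmetric]) auto
  moreover have "Suc (card (K - {u})) = card K"
    using assms finite_vertices by (intro card_Suc_Diff1)
  ultimately show ?thesis by simp
qed

lemma neighbours_in_independent:
  assumes "s \<in> S" and "{v, s} \<in> E"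
  shows "v \<in> K"
  using assms cover independent[unfolded independent_set_def] edgeD[of v s] by blast

lemma degree_in_independent:
  assumes "s \<in> S"
  shows "degree E s = card {v \<in> K. {v, s} \<in> E}"
proof -
  have "{v. {v, s} \<in> E} = {v \<in> K. {v, s} \<in> E}"
    using neighbours_in_independent[OF assms] by blast
  then show ?thesis by (simp add: degree_def)
qed

end

lemma split_graph_iff: "split_graph V E \<longleftrightarrow> (\<exists>S K. split_partition V E S K)"
  by (auto simp: split_graph_def split_partition_def)

section \<open>The upper bound for the number of parts\<close>

context split_partition
begin

text \<open>
  Let \<open>i\<close> be the last part that meets the independent side. It suffices that each of the other
  parts contributes two vertices of degree at least \<open>2 m\<close>, or one if it is the last part. A part after
  \<open>i\<close> lies in the clique, and its vertices have the required neighbours in part \<open>i\<close> outside the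
  clique. In a part before \<open>i\<close>, the clique vertices adjacent to a fixed independent vertex \<open>s\<close> of
  part \<open>i\<close> have high degree as soon as the clique has \<open>2 m\<close> vertices. Otherwise all counts are
  tight: part \<open>i\<close> is independent and each earlier part has exactly two clique vertices, which are
  therefore adjacent to all of part \<open>i\<close>.
\<close>

lemma many_high_degrees:
  assumes part: "two_transitive_partition V E Ps" and len: "length Ps = Suc m"
  shows "2 * m \<le> Suc (card (high_degree V E (2 * m)))"
proof -
  define G where "G = high_degree V E (2 * m)"
  define W where "W j = Ps ! j" for j
  \<comment> \<open>The contribution required of part \<open>j\<close>. It is also a lower bound for the size of the part.\<close>
  define low where "low j = (if j < m then 2 else 1 :: nat)" for j
  have dist: "distinct Ps" and pon: "partition_on V (set Ps)"
    using part by (auto simp: two_transitive_partition_def)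
  have set_Ps: "set Ps = W ` {..m}"
    using len by (auto simp: W_def set_conv_nth less_Suc_eq_le)
  have U: "(\<Union>j\<le>m. W j) = V"
    using pon by (simp add: partition_on_def set_Ps)
  have ne: "W j \<noteq> {}" if "j \<le> m" for j
    using pon that by (auto simp: partition_on_def set_Ps)
  have inj: "W j \<noteq> W l" if "j \<le> m" "l \<le> m" "j \<noteq> l" for j l
    using dist that len by (simp add: W_def nth_eq_iff_index_eq)
  have disj: "W j \<inter> W l = {}" if "j \<le> m" "l \<le> m" "j \<noteq> l" for j l
    using pon that inj[OF that] by (auto simp: partition_on_def disjoint_def set_Ps)
  have dom: "2 \<le> card {a \<in> W l. {a, b} \<in> E}" if "l < j" "j \<le> m" "b \<in> W j" for l j b
  proof -
    have "two_dominates E (W l) (W j)"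
      using part that len by (simp add: two_transitive_partition_def W_def)
    then show ?thesis using that by (simp add: two_dominates_def)
  qed
  have finW: "finite (W j)" if "j \<le> m" for j
    using U that by (intro finite_subset[OF _ finite_vertices(1)]) auto
  have card2: "2 \<le> card (W j)" if "j < m" for j
  proof -
    obtain b where "b \<in> W m" using ne by blast
    with dom[of j m b] that have "2 \<le> card {a \<in> W j. {a, b} \<in> E}" by simp
    also have "\<dots> \<le> card (W j)" using finW that by (intro card_mono) auto
    finally show ?thesis .
  qed
  have lowW: "low j \<le> card (W j)" if "j \<le> m" for j
    using card2[of j] ne[OF that] finW[OF that]
    by (auto simp: low_def Suc_le_eq card_gt_0_iff)
  have card_sum: "card A = (\<Sum>j\<le>m. card (A \<inter> W j))" if "A \<subseteq> V" for A
  proof -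
    have "A = (\<Union>j\<le>m. A \<inter> W j)" using that U by blast
    moreover have "card (\<Union>j\<le>m. A \<inter> W j) = (\<Sum>j\<le>m. card (A \<inter> W j))"
      using finW disj by (intro card_UN_disjoint) auto
    ultimately show ?thesis by simp
  qed
  have low_sum: "(\<Sum>j\<le>m. low j) = 2 * m + 1"
  proof -
    have "(\<Sum>j\<le>m. low j) = (\<Sum>j<m. low j) + low m"
      by (simp add: lessThan_Suc_atMost[symmetric])
    then show ?thesis by (simp add: low_def)
  qed
  have G_iff: "u \<in> G \<longleftrightarrow> u \<in> V \<and> 2 * m \<le> degree E u" for u
    by (simp add: G_def high_degree_def)
  have "2 * m \<le> Suc (card G)"
  proof (cases "S = {}")
    case True
    then have KV: "K = V" using cover by simp
    have "2 * m + 1 \<le> card V"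
      unfolding low_sum[symmetric] card_sum[OF subset_refl]
    proof (rule sum_mono)
      fix j assume "j \<in> {..m}"
      moreover have "V \<inter> W j = W j" using U calculation by blast
      ultimately show "low j \<le> card (V \<inter> W j)" using lowW by simp
    qed
    moreover have "V \<subseteq> G"
    proof
      fix u assume "u \<in> V"
      moreover have "Suc (degree E u) = card V"
        using degree_in_clique[of u] KV True \<open>u \<in> V\<close> by simp
      ultimately show "u \<in> G" using \<open>2 * m + 1 \<le> card V\<close> by (simp add: G_iff)
    qed
    then have "card V \<le> card G"
      using finite_vertices by (intro card_mono) (auto simp: G_def high_degree_def)
    ultimately show ?thesis by simp
  next
    case False
    define i where "i = Max {j. j \<le> m \<and> W j \<inter> S \<noteq> {}}"
    have "{j. j \<le> m \<and> W j \<inter> S \<noteq> {}} \<noteq> {}" using False U cover by blast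
    moreover have fin: "finite {j. j \<le> m \<and> W j \<inter> S \<noteq> {}}" by simp
    ultimately have "i \<in> {j. j \<le> m \<and> W j \<inter> S \<noteq> {}}"
      unfolding i_def by (intro Max_in)
    then obtain s where im: "i \<le> m" and s: "s \<in> W i" "s \<in> S" by blast
    have after: "W j \<subseteq> K" if "i < j" "j \<le> m" for j
    proof -
      have "W j \<inter> S = {}"
        using Max_ge[OF fin, of j] that by (fastforce simp: i_def[symmetric])
      then show ?thesis using U cover that by blast
    qed
    have nbrs: "2 \<le> card {a \<in> K \<inter> W j. {a, s'} \<in> E}" if "s' \<in> S" "s' \<in> W i" "j < i" for j s'
    proof -
      have "{a \<in> W j. {a, s'} \<in> E} = {a \<in> K \<inter> W j. {a, s'} \<in> E}"
        using neighbours_in_independent[OF that(1)] by blast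
      then show ?thesis using dom[OF that(3) im that(2)] by simp
    qed
    have finK: "finite (K \<inter> X)" for X using finite_vertices by simp
    have lowK: "low j \<le> card (K \<inter> W j)" if "j \<in> {..m} - {i}" for j
    proof (cases "j < i")
      case True
      have "2 \<le> card {a \<in> K \<inter> W j. {a, s} \<in> E}" using nbrs s True by blast
      also have "\<dots> \<le> card (K \<inter> W j)" by (rule card_mono[OF finK]) blast
      finally show ?thesis by (simp add: low_def)
    next
      case False
      then have "K \<inter> W j = W j" using after[of j] that by auto
      then show ?thesis using lowW that by simp
    qed
    let ?R = "{..m} - {i}"
    have rest: "(\<Sum>j\<le>m. f j) = f i + (\<Sum>j\<in>?R. f j)" for f :: "nat \<Rightarrow> nat"
      using im by (intro sum.remove) auto
    have low_rest: "low i + (\<Sum>j\<in>?R. low j) = 2 * m + 1" using low_sum rest[of low] by simp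
    have K_sum: "card K = card (K \<inter> W i) + (\<Sum>j\<in>?R. card (K \<inter> W j))"
      using card_sum[of K] cover rest[of "\<lambda>j. card (K \<inter> W j)"] by auto
    have "(\<Sum>j\<in>?R. low j) \<le> (\<Sum>j\<in>?R. card (K \<inter> W j))"
      by (rule sum_mono) (rule lowK)
    then have K_ge: "2 * m + 1 + card (K \<inter> W i) \<le> card K + low i"
      using K_sum low_rest by linarith
    have low_le: "low j \<le> 2" for j by (simp add: low_def)
    \<comment> \<open>Summing this over all parts except \<open>i\<close> proves the claim.\<close>
    have lowG: "low j \<le> card (G \<inter> W j)" if j: "j \<in> ?R" for j
    proof (cases "j < i")
      case False
      then have ij: "i < j" "j \<le> m" using j by auto
      have "u \<in> G" if u: "u \<in> W j" for u
      proof -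
        have uK: "u \<in> K" using after ij u by blast
        have "2 \<le> card {a \<in> W i. {a, u} \<in> E}" using dom ij u by blast
        also have "\<dots> \<le> card ((K \<inter> W i) \<union> {s \<in> S. {s, u} \<in> E})"
          using finite_vertices U cover im by (intro card_mono) auto
        also have "\<dots> \<le> card (K \<inter> W i) + card {s \<in> S. {s, u} \<in> E}"
          by (rule card_Un_le)
        finally show ?thesis
          using degree_in_clique[OF uK] K_ge low_le[of i] uK cover by (auto simp: G_iff)
      qed
      then have "G \<inter> W j = W j" by blast
      then show ?thesis using lowW ij by simp
    next
      case ji: True
      show ?thesis
      proof (cases "2 * m \<le> card K")
        case True
        have "u \<in> G" if u: "u \<in> K" "{u, s} \<in> E" for u
        proof -
          have "s \<in> {s \<in> S. {s, u} \<in> E}" using u s by (simp add: insert_commute)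
          then have "0 < card {s \<in> S. {s, u} \<in> E}"
            using finite_vertices by (auto simp: card_gt_0_iff)
          then show ?thesis
            using degree_in_clique[OF u(1)] True u cover by (auto simp: G_iff)
        qed
        then have "card {a \<in> K \<inter> W j. {a, s} \<in> E} \<le> card (G \<inter> W j)"
          using finW j by (intro card_mono) auto
        then show ?thesis using nbrs[OF s(2,1) ji] low_le[of j] by linarith
      next
        case False
        \<comment> \<open>By \<open>K_ge\<close> the clique cannot be smaller still, so all estimates behind \<open>K_ge\<close> are equalities.\<close>
        then have Ki: "card (K \<inter> W i) = 0" "low i = 2" and cK: "card K = 2 * m - 1"
          using K_ge low_le[of i] by linarith+
        then have Wi: "W i \<subseteq> S" and "i < m"
          using finK U cover im by (auto simp: low_def split: if_splits)
        have Kj: "card (K \<inter> W j) \<le> 2"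
        proof (rule ccontr)
          assume "\<not> ?thesis"
          then have "low j < card (K \<inter> W j)" using low_le[of j] by linarith
          then have "(\<Sum>j\<in>?R. low j) < (\<Sum>j\<in>?R. card (K \<inter> W j))"
            using lowK j by (intro sum_strict_mono_ex1) auto
          then show False using K_sum low_rest False Ki by linarith
        qed
        have "u \<in> G" if u: "u \<in> K \<inter> W j" for u
        proof -
          have "{s', u} \<in> E" if s': "s' \<in> W i" for s'
          proof -
            have "{a \<in> K \<inter> W j. {a, s'} \<in> E} = K \<inter> W j"
              using nbrs[of s' j] s' Wi ji Kj by (intro card_seteq[OF finK]) auto
            then show ?thesis using u by (auto simp: insert_commute)
          qed
          then have "card (W i) \<le> card {s \<in> S. {s, u} \<in> E}"
            using Wi finite_vertices by (intro card_mono) auto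
          then show ?thesis
            using degree_in_clique[of u] card2[OF \<open>i < m\<close>] cK \<open>i < m\<close> u cover
            by (auto simp: G_iff)
        qed
        then have "card (K \<inter> W j) \<le> card (G \<inter> W j)"
          using finW j by (intro card_mono) auto
        then show ?thesis using lowK[OF j] by linarith
      qed
    qed
    have "(\<Sum>j\<in>?R. low j) \<le> (\<Sum>j\<in>?R. card (G \<inter> W j))"
      by (rule sum_mono) (rule lowG)
    also have "\<dots> \<le> card G"
      using card_sum[of G] rest[of "\<lambda>j. card (G \<inter> W j)"] by (simp add: G_def high_degree_def)
    finally show ?thesis using low_rest low_le[of i] by linarith
  qed
  then show ?thesis by (simp add: G_def)
qed

end

section \<open>An optimal partition\<close>

lemma two_transitive_partition_of_colouring:
  assumes c: "c ` V = {..<k}"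
    and dom: "\<And>i v. v \<in> V \<Longrightarrow> i < c v \<Longrightarrow> 2 \<le> card {a \<in> V. c a = i \<and> {a, v} \<in> E}"
  shows "two_transitive_partition V E (map (\<lambda>i. {v \<in> V. c v = i}) [0..<k])"
proof -
  let ?P = "\<lambda>i. {v \<in> V. c v = i}"
  have ne: "?P i \<noteq> {}" if "i < k" for i
  proof -
    have "i \<in> c ` V" using that c by simp
    then show ?thesis by auto
  qed
  have inj: "inj_on ?P {..<k}"
  proof (rule inj_onI)
    fix i j assume "i \<in> {..<k}" "?P i = ?P j"
    then show "i = j" using ne[of i] by auto
  qed
  have "c v < k" if "v \<in> V" for v using c that by auto
  then have "partition_on V (?P ` {..<k})"
    using ne by (intro partition_onI) (auto simp: disjnt_def)
  moreover have "two_dominates E (?P i) (?P j)" if "i < j" for i j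
    using dom that by (auto simp: two_dominates_def)
  ultimately show ?thesis
    using inj by (auto simp: two_transitive_partition_def distinct_map atLeast0LessThan)
qed

context split_partition
begin

text \<open>
  Two clique vertices in each of the parts \<open>1, 2, \<dots>\<close> before the last 2-dominate every later part, as
  later parts consist of clique vertices. If there is a part \<open>1\<close>, then starting the
  numbering at \<open>r\<close> leaves \<open>2 - r\<close> clique vertices for part \<open>0\<close>, and the independent side supplies the other \<open>r\<close> neighbours.
\<close>

lemma two_transitive_partition_by_pairs:
  fixes num :: "'a \<Rightarrow> nat"
  assumes "V \<noteq> {}" and r: "r \<le> 2" "0 < r + card K"
    and S_nbrs: "\<And>u. u \<in> K \<Longrightarrow> r \<le> card {s \<in> S. {s, u} \<in> E}"
    and num: "bij_betw num K {r..<r + card K}"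
  defines "c \<equiv> \<lambda>v. if v \<in> K then num v div 2 else 0"
  shows "two_transitive_partition V E
           (map (\<lambda>i. {v \<in> V. c v = i}) [0..<Suc (r + card K) div 2])"
proof (rule two_transitive_partition_of_colouring)
  let ?k = "Suc (r + card K) div 2"
  have num_range: "r \<le> num u" "num u < r + card K" if "u \<in> K" for u
    using bij_betwE[OF num] that by auto
  have num_surj: "\<exists>u\<in>K. num u = i" if "r \<le> i" "i < r + card K" for i
    using num that by (metis atLeastLessThan_iff bij_betw_iff_bijections)
  have card_num: "card {a \<in> K. num a \<in> X} = card X" if X: "X \<subseteq> {r..<r + card K}" for X
  proof (rule bij_betw_same_card)
    show "bij_betw num {a \<in> K. num a \<in> X} X"
      unfolding bij_betw_def
    proof (intro conjI equalityI subsetI)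
      show "inj_on num {a \<in> K. num a \<in> X}"
        using num by (auto simp: bij_betw_def inj_on_def)
      fix x assume "x \<in> X"
      then obtain u where "u \<in> K" "num u = x" using X num_surj[of x] by (auto simp: subset_iff)
      then show "x \<in> num ` {a \<in> K. num a \<in> X}" using \<open>x \<in> X\<close> by auto
    qed auto
  qed
  show "c ` V = {..<?k}"
  proof (intro equalityI subsetI)
    fix i assume "i \<in> c ` V"
    then obtain v where "v \<in> V" "i = c v" by auto
    then show "i \<in> {..<?k}" using r num_range[of v] by (auto simp: c_def)
  next
    fix i assume i: "i \<in> {..<?k}"
    consider "i = 0" "S \<noteq> {}" | "i = 0" "S = {}" | "0 < i" by blast
    then show "i \<in> c ` V"
    proof cases
      case 1
      then obtain s where "s \<in> S" by auto
      then have "s \<in> V" "c s = i" using 1 cover disjoint by (auto simp: c_def)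
      then show ?thesis by auto
    next
      case 2
      then have "K \<noteq> {}" using \<open>V \<noteq> {}\<close> cover by auto
      then obtain u where "u \<in> K" by auto
      \<comment> \<open>With \<open>S\<close> empty, only clique vertices can fill part \<open>0\<close>; this works because \<open>r\<close> vanishes.\<close>
      then have "r = 0" using S_nbrs[of u] 2 by simp
      then obtain u where "u \<in> K" "num u = 0" using num_surj[of 0] r by auto
      then have "u \<in> V" "c u = i" using 2 cover by (auto simp: c_def)
      then show ?thesis by blast
    next
      case 3
      have "r \<le> 2 * i" "2 * i < r + card K" using 3 r i by auto
      then obtain u where "u \<in> K" "num u = 2 * i" using num_surj[of "2 * i"] by auto
      then have "u \<in> V" "c u = i" using cover by (auto simp: c_def)
      then show ?thesis by blast
    qed
  qed
  fix i v assume v: "v \<in> V" "i < c v"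
  then have vK: "v \<in> K" and i: "i < num v div 2" by (auto simp: c_def split: if_splits)
  have adj: "{a, v} \<in> E" if "a \<in> K" "num a < num v" for a
    using clique vK that by (auto simp: clique_def)
  have fin: "finite {a \<in> V. c a = i \<and> {a, v} \<in> E}" using finite_vertices by auto
  show "2 \<le> card {a \<in> V. c a = i \<and> {a, v} \<in> E}"
  proof (cases "i = 0")
    case False
    have "2 = card {2 * i, Suc (2 * i)}" by simp
    also have "\<dots> = card {a \<in> K. num a \<in> {2 * i, Suc (2 * i)}}"
      by (rule card_num[symmetric]) (use False r i num_range[OF vK] in auto)
    also have "\<dots> \<le> card {a \<in> V. c a = i \<and> {a, v} \<in> E}"
      by (rule card_mono[OF fin]) (use adj i cover in \<open>auto simp: c_def\<close>)
    finally show ?thesis .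
  next
    case True
    let ?A = "{a \<in> K. num a \<in> {r..<2}}" and ?N = "{s \<in> S. {s, v} \<in> E}"
    have "{r..<2} \<subseteq> {r..<r + card K}" using i num_range[OF vK] by auto
    then have "card ?A = 2 - r" using card_num[of "{r..<2}"] by simp
    then have "2 \<le> card ?A + card ?N" using S_nbrs[OF vK] by linarith
    also have "\<dots> = card (?A \<union> ?N)"
      by (rule card_Un_disjoint[symmetric]) (use finite_vertices disjoint in auto)
    also have "\<dots> \<le> card {a \<in> V. c a = i \<and> {a, v} \<in> E}"
      by (rule card_mono[OF fin]) (use adj i True cover disjoint in \<open>auto simp: c_def\<close>)
    finally show ?thesis .
  qed
qed

end

text \<open>
  In a split partition with a clique \<open>K\<close> of maximum size, all degrees outside \<open>K\<close> are less than
  \<open>|K|\<close>. Degrees in \<open>K\<close> are at least \<open>|K| - 1\<close>, so \<open>t \<ge> |K| - 1\<close>. If \<open>t \<ge> |K|\<close>, the vertices of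
  degree at least \<open>t\<close> lie in \<open>K\<close>. Being at least \<open>t - 1\<close> many, they then miss at most one vertex
  of \<open>K\<close>, which has no neighbour outside \<open>K\<close> and can change sides. If \<open>t = |K| - 1\<close>, the maximality
  of \<open>t\<close> yields two vertices of \<open>K\<close> without neighbours outside \<open>K\<close>, so that every outside vertex
  has degree less than \<open>t\<close>.
\<close>

lemma split_partition_high_degree:
  assumes split: "split_graph V E" and t: "degree_threshold V E t"
  shows "split_partition V E (V - high_degree V E t) (high_degree V E t)"
    and "card (high_degree V E t) \<le> Suc t"
proof -
  let ?D = "high_degree V E t"
  let ?P = "\<lambda>K. split_partition V E (V - K) K"
  obtain S0 K0 where sp0: "split_partition V E S0 K0" using split by (auto simp: split_graph_iff)
  moreover have "S0 = V - K0"
    using split_partition.cover[OF sp0] split_partition.disjoint[OF sp0] by blast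
  ultimately have "?P K0" by simp
  moreover have "\<forall>K. ?P K \<longrightarrow> card K < Suc (card V)"
    by (intro allI impI le_imp_less_Suc)
      (metis card_mono split_partition.cover split_partition.finite_vertices(1) sup_ge2)
  ultimately obtain K where K: "?P K" and maximal: "\<And>K'. ?P K' \<Longrightarrow> card K' \<le> card K"
    using Lattices_Big.ex_has_greatest_nat[of ?P K0 card "Suc (card V)"] by blast
  interpret split_partition V E "V - K" K by (rule K)
  have KV: "K \<subseteq> V" using cover by blast
  \<comment> \<open>A vertex adjacent to all of \<open>K\<close> could be added to \<open>K\<close>.\<close>
  have low_S: "degree E s < card K" if s: "s \<in> V - K" for s
  proof (rule ccontr)
    assume "\<not> ?thesis"
    then have "{v \<in> K. {v, s} \<in> E} = K"
      using degree_in_independent[OF s] finite_vertices by (intro card_seteq) auto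
    then have "{v, s} \<in> E \<and> {s, v} \<in> E" if "v \<in> K" for v
      using that unfolding insert_commute[of s v "{}"] by blast
    then have "clique E (insert s K)"
      using clique unfolding clique_def by blast
    moreover have "independent_set E (V - insert s K)"
      using independent by (auto simp: independent_set_def)
    ultimately have "?P (insert s K)"
      using KV s simple by (auto simp: split_partition_def)
    then show False using maximal[of "insert s K"] s finite_vertices by simp
  qed
  have finD: "finite ?D" using finite_vertices by (simp add: high_degree_def)
  have clique_deg: "card K \<le> Suc (degree E u)" if "u \<in> K" for u
    using degree_in_clique[OF that] by simp
  have t_le: "t \<le> Suc (card ?D)"
    and t_max: "\<And>u. t < u \<Longrightarrow> Suc (card (high_degree V E u)) < u"
    using t by (auto simp: degree_threshold_def)
  have K_sub: "K \<subseteq> high_degree V E (card K - 1)"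
    using clique_deg KV by (auto simp: high_degree_def le_diff_conv)
  have "card K \<le> Suc t"
  proof (rule ccontr)
    assume "\<not> ?thesis"
    then have "Suc (card (high_degree V E (card K - 1))) < card K - 1" by (intro t_max) simp
    moreover have "card K \<le> card (high_degree V E (card K - 1))"
      using K_sub finite_vertices by (intro card_mono) (auto simp: high_degree_def)
    ultimately show False by simp
  qed
  have no_nbr: "{v, x} \<notin> E" if "x \<in> K" "degree E x < card K" "v \<in> V - K" for v x
  proof
    assume "{v, x} \<in> E"
    then have "v \<in> {s \<in> V - K. {s, x} \<in> E}" using that by simp
    then have "0 < card {s \<in> V - K. {s, x} \<in> E}"
      using finite_vertices by (auto simp: card_gt_0_iff)
    then show False using degree_in_clique[OF that(1)] that(2) by simp
  qed
  have "?D = K \<or> (\<exists>x\<in>K. ?D = K - {x} \<and> degree E x < card K)"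
  proof (cases "card K \<le> t")
    case True
    then have DK: "?D \<subseteq> K" using low_S by (fastforce simp: high_degree_def)
    show ?thesis
    proof (cases "?D = K")
      case False
      then have "card ?D < card K" using DK finite_vertices by (simp add: psubset_card_mono psubsetI)
      then have "card (K - ?D) = 1" and "t = card K"
        using True t_le DK finD by (simp_all add: card_Diff_subset)
      then obtain x where "K - ?D = {x}" by (auto simp: card_1_singleton_iff)
      then have "x \<in> K" "?D = K - {x}" "degree E x < card K"
        using DK KV \<open>t = card K\<close> by (auto simp: high_degree_def)
      then show ?thesis by blast
    qed simp
  next
    case False
    then have cK: "card K = Suc t" using \<open>card K \<le> Suc t\<close> by simp
    \<comment> \<open>The clique vertices without neighbours outside \<open>K\<close>; there are at least two of them.\<close>
    let ?L = "{x \<in> K. degree E x = t}"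
    have "K - ?L \<subseteq> high_degree V E (Suc t)"
      using clique_deg KV cK by (fastforce simp: high_degree_def)
    then have "card (K - ?L) \<le> card (high_degree V E (Suc t))"
      using finite_vertices by (intro card_mono) (auto simp: high_degree_def)
    also have "\<dots> < t" using t_max[of "Suc t"] by simp
    finally have L: "2 \<le> card ?L"
      using cK finite_vertices card_Diff_subset[of ?L K] by (simp add: subset_iff)
    have "degree E s < t" if s: "s \<in> V - K" for s
    proof -
      have "{v \<in> K. {v, s} \<in> E} \<subseteq> K - ?L"
        using no_nbr[OF _ _ s] cK by (auto simp: insert_commute[of s])
      then have "degree E s \<le> card (K - ?L)"
        using degree_in_independent[OF s] finite_vertices by (simp add: card_mono)
      then show ?thesis using \<open>card (high_degree V E (Suc t)) < t\<close> 
         \<open>card (K - ?L) \<le> card (high_degree V E (Suc t))\<close> by linarith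
    qed
    then have "?D = K"
      using clique_deg KV cK by (fastforce simp: high_degree_def)
    then show ?thesis by simp
  qed
  then show "?P ?D" and "card ?D \<le> Suc t"
  proof (atomize (full), elim disjE bexE conjE)
    assume "?D = K"
    then show "?P ?D \<and> card ?D \<le> Suc t" using K \<open>card K \<le> Suc t\<close> by simp
  next
    fix x assume x: "x \<in> K" "?D = K - {x}" "degree E x < card K"
    have "independent_set E (V - (K - {x}))"
      unfolding independent_set_def
    proof (intro ballI)
      fix u v assume "u \<in> V - (K - {x})" "v \<in> V - (K - {x})"
      then consider "u \<in> V - K" "v \<in> V - K" | "u = x" "v = x"
        | "u = x" "v \<in> V - K" | "u \<in> V - K" "v = x" by blast
      then show "{u, v} \<notin> E"
      proof cases
        case 1
        then show ?thesis using independent unfolding independent_set_def by blast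
      next
        case 2
        then show ?thesis using edgeD(3)[of u v] by blast
      next
        case 3
        then show ?thesis using no_nbr[OF x(1,3), of v] insert_commute[of u v "{}"] by simp
      next
        case 4
        then show ?thesis using no_nbr[OF x(1,3), of u] by simp
      qed
    qed
    moreover have "clique E (K - {x})" using clique by (auto simp: clique_def)
    ultimately have "?P ?D" using x(2) KV simple by (auto simp: split_partition_def)
    moreover have "card ?D \<le> card K" using x(2) finite_vertices by (simp add: card_mono)
    ultimately show "?P ?D \<and> card ?D \<le> Suc t" using \<open>card K \<le> Suc t\<close> by simp
  qed
qed

text \<open>The numbering of the clique is by rank in the order of the vertices, since this is the order in
  which the program visits them.\<close>

lemma Tr2_split_graph:
  fixes V :: "nat set"
  assumes split: "split_graph V E" and t: "degree_threshold V E t" and "V \<noteq> {}"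
  defines "D \<equiv> high_degree V E t"
  defines "c \<equiv> \<lambda>v. if v \<in> D then (Suc t - card D + card {u \<in> D. u < v}) div 2 else 0"
  shows "two_transitive_partition V E (map (\<lambda>i. {v \<in> V. c v = i}) [0..<Suc (t div 2)])"
    and "Tr2 V E = Suc (t div 2)"
proof -
  interpret split_partition V E "V - D" D
    unfolding D_def by (rule split_partition_high_degree(1)[OF split t])
  have D_le: "card D \<le> Suc t"
    unfolding D_def by (rule split_partition_high_degree(2)[OF split t])
  have t_le: "t \<le> Suc (card D)"
    and t_max: "\<And>u. t < u \<Longrightarrow> Suc (card (high_degree V E u)) < u"
    using t by (auto simp: degree_threshold_def D_def)
  let ?r = "Suc t - card D"
  let ?num = "\<lambda>v. ?r + card {u \<in> D. u < v}"
  have inj: "inj_on ?num D"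
  proof (rule linorder_inj_onI')
    fix u v assume "u \<in> D" "v \<in> D" "u < v"
    then have "{w \<in> D. w < u} \<subset> {w \<in> D. w < v}" by auto
    then have "card {w \<in> D. w < u} < card {w \<in> D. w < v}"
      using finite_vertices by (intro psubset_card_mono) auto
    then show "?num u \<noteq> ?num v" by simp
  qed
  have "?num ` D \<subseteq> {?r..<?r + card D}"
  proof clarsimp
    fix v assume "v \<in> D"
    then have "{u \<in> D. u < v} \<subset> D" by auto
    then show "card {u \<in> D. u < v} < card D" using finite_vertices by (intro psubset_card_mono)
  qed
  then have "bij_betw ?num D {?r..<?r + card D}"
    using inj by (simp add: bij_betw_def card_subset_eq card_image)
  then have "two_transitive_partition V E
      (map (\<lambda>i. {v \<in> V. (if v \<in> D then ?num v div 2 else 0) = i}) [0..<Suc (?r + card D) div 2])"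
  proof (rule two_transitive_partition_by_pairs[rotated -1])
    fix u assume u: "u \<in> D"
    then have "t \<le> degree E u" by (simp add: D_def high_degree_def)
    then show "?r \<le> card {s \<in> V - D. {s, u} \<in> E}"
      using degree_in_clique[OF u] by linarith
  qed (use \<open>V \<noteq> {}\<close> t_le D_le in auto)
  then show P: "two_transitive_partition V E (map (\<lambda>i. {v \<in> V. c v = i}) [0..<Suc (t div 2)])"
    using D_le by (simp add: c_def)
  obtain Ps where Ps: "two_transitive_partition V E Ps" "length Ps = Tr2 V E"
    using Tr2_attained[OF finite_vertices(1)] by blast
  have "Tr2 V E \<le> Suc (t div 2)"
  proof (cases "Tr2 V E")
    case (Suc m)
    then have "2 * m \<le> Suc (card (high_degree V E (2 * m)))"
      using many_high_degrees[OF Ps(1), of m] Ps(2) by simp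
    then have "2 * m \<le> t" using t_max[of "2 * m"] by linarith
    then show ?thesis using Suc by simp
  qed simp
  moreover have "Suc (t div 2) \<le> Tr2 V E" using Tr2_upper[OF finite_vertices(1) P] by simp
  ultimately show "Tr2 V E = Suc (t div 2)" by simp
qed

section \<open>Reasoning about programs\<close>

text \<open>Weakest preconditions for total correctness in which the postcondition also sees the running
  time. The equations below let the simplifier run loop-free code symbolically, including the check
  that all computed values fit into a machine word.\<close>

definition wp :: "nat \<Rightarrow> com \<Rightarrow> (nat \<Rightarrow> state \<Rightarrow> bool) \<Rightarrow> state \<Rightarrow> bool" where
  "wp w c Q s \<longleftrightarrow> (\<exists>t s'. exec w c s t s' \<and> Q t s')"

lemma wp_Skip: "wp w Skip Q s \<longleftrightarrow> Q 1 s"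
  unfolding wp_def by (metis exec_Skip exec_deterministic)

lemma wp_Assign: "wp w (Assign x e) Q s \<longleftrightarrow>
    expr_val e s < w \<and> Q 1 (s\<lparr>regs := (regs s)(x := expr_val e s)\<rparr>)"
  unfolding wp_def by (metis AssignE exec_Assign)

lemma wp_Write: "wp w (Write a x y) Q s \<longleftrightarrow>
    Q 1 (s\<lparr>arrs := (arrs s)(a := (arrs s a)(regs s x := regs s y))\<rparr>)"
  unfolding wp_def by (metis exec_Write exec_deterministic)

lemma wp_Seq: "wp w (Seq c1 c2) Q s \<longleftrightarrow> wp w c1 (\<lambda>t. wp w c2 (\<lambda>u. Q (t + u))) s"
  unfolding wp_def by (blast intro: exec_Seq elim: SeqE)

lemma wp_Cond: "wp w (Cond b c1 c2) Q s \<longleftrightarrow>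
    (if test_val b s then wp w c1 (\<lambda>t. Q (1 + t)) s else wp w c2 (\<lambda>t. Q (1 + t)) s)"
  unfolding wp_def
  by (auto elim!: CondE intro: exec_Cond_True[unfolded plus_1_eq_Suc]
      exec_Cond_False[unfolded plus_1_eq_Suc])

lemmas wp_simps = wp_Skip wp_Assign wp_Write wp_Seq wp_Cond

lemma wp_mono: "wp w c P s \<Longrightarrow> (\<And>t s'. P t s' \<Longrightarrow> Q t s') \<Longrightarrow> wp w c Q s"
  unfolding wp_def by blast

text \<open>The variant \<open>\<mu>\<close> bounds the number of iterations, and \<open>B\<close> the time for one execution of the
  body; each iteration costs one more unit for the test.\<close>

lemma wp_While:
  assumes "I s"
    and body: "\<And>s. I s \<Longrightarrow> test_val b s \<Longrightarrow> wp w c (\<lambda>t s'. t \<le> B \<and> I s' \<and> \<mu> s' < \<mu> s) s"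
    and exit: "\<And>t s'. I s' \<Longrightarrow> \<not> test_val b s' \<Longrightarrow> t \<le> 1 + \<mu> s * Suc B \<Longrightarrow> Q t s'"
  shows "wp w (While b c) Q s"
proof -
  have "wp w (While b c) (\<lambda>t s'. t \<le> 1 + \<mu> s * Suc B \<and> I s' \<and> \<not> test_val b s') s"
    using \<open>I s\<close>
  proof (induction "\<mu> s" arbitrary: s rule: less_induct)
    case less
    show ?case
    proof (cases "test_val b s")
      case False
      then show ?thesis
        using exec_While_False[OF False] less.prems unfolding wp_def by fastforce
    next
      case True
      then obtain t1 s1 where s1: "exec w c s t1 s1" "t1 \<le> B" "I s1" "\<mu> s1 < \<mu> s"
        using body[OF less.prems] unfolding wp_def by blast
      then obtain t2 s2 where s2: "exec w (While b c) s1 t2 s2"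
          "t2 \<le> 1 + \<mu> s1 * Suc B" "I s2" "\<not> test_val b s2"
        using less.hyps[of s1] unfolding wp_def by blast
      have "Suc (\<mu> s1) * Suc B \<le> \<mu> s * Suc B" using s1(4) by (intro mult_le_mono1) simp
      then have "1 + t1 + t2 \<le> 1 + \<mu> s * Suc B" using s1(2) s2(2) by simp
      then show ?thesis
        using exec_While_True[OF True s1(1) s2(1)] s2(3,4) unfolding wp_def by blast
    qed
  qed
  then show ?thesis by (rule wp_mono) (use exit in blast)
qed

section \<open>The program\<close>

notation Seq (infixr \<open>;;\<close> 60)

abbreviation (input) "R_n \<equiv> 0 :: nat"
abbreviation (input) "R_one \<equiv> 11 :: nat"
abbreviation (input) "R_vertex \<equiv> 2 :: nat"
abbreviation (input) "R_temp \<equiv> 3 :: nat"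
abbreviation (input) "R_next \<equiv> 4 :: nat"
abbreviation (input) "R_degree \<equiv> 5 :: nat"
abbreviation (input) "R_count \<equiv> 6 :: nat"
abbreviation (input) "R_threshold \<equiv> 7 :: nat"
abbreviation (input) "R_bound \<equiv> 8 :: nat"
abbreviation (input) "R_half \<equiv> 9 :: nat"
abbreviation (input) "R_half_up \<equiv> 10 :: nat"
abbreviation (input) "A_offset \<equiv> 0 :: nat"
abbreviation (input) "A_part \<equiv> 2 :: nat"
abbreviation (input) "A_tally \<equiv> 3 :: nat"

text \<open>This also leaves the next vertex in its register, to which the loops over all vertices
  proceed at the end of their bodies.\<close>

definition load_degree :: com where
  "load_degree =
     Assign R_next (Plus R_vertex R_one) ;;
     Assign R_temp (Read A_offset R_vertex) ;;
     Assign R_degree (Read A_offset R_next) ;;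
     Assign R_degree (Minus R_degree R_temp)"

text \<open>Takes \<open>(\<lfloor>j / 2\<rfloor>, \<lceil>j / 2\<rceil>)\<close> to \<open>(\<lfloor>(j + 1) / 2\<rfloor>, \<lceil>(j + 1) / 2\<rceil>)\<close>.\<close>

definition advance_halves :: com where
  "advance_halves =
     Assign R_temp (Plus R_half R_one) ;;
     Assign R_half (Reg R_half_up) ;;
     Assign R_half_up (Reg R_temp)"

definition tally_degrees :: com where
  "tally_degrees =
     While (Less R_vertex R_n)
       (load_degree ;;
        Assign R_temp (Read A_tally R_degree) ;;
        Assign R_temp (Plus R_temp R_one) ;;
        Write A_tally R_degree R_temp ;;
        Assign R_vertex (Reg R_next))"

text \<open>\<open>R_count\<close> is one more than the number of vertices of degree at least \<open>R_threshold\<close>, so that the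
  test of the loop is a single comparison.\<close>

definition find_threshold :: com where
  "find_threshold =
     Assign R_count (Const 1) ;;
     Assign R_threshold (Reg R_n) ;;
     While (Less R_count R_threshold)
       (Assign R_threshold (Minus R_threshold R_one) ;;
        Assign R_temp (Read A_tally R_threshold) ;;
        Assign R_count (Plus R_count R_temp))"

text \<open>Advances the halves \<open>t + 2 - R_count = t + 1 - |D|\<close> times, where the numbering of \<open>D\<close> starts.\<close>

definition skip_numbers :: com where
  "skip_numbers =
     Assign R_bound (Const 2) ;;
     Assign R_bound (Plus R_threshold R_bound) ;;
     While (Less R_count R_bound)
       (Assign R_count (Plus R_count R_one) ;;
        advance_halves)"

text \<open>Vertices of degree below the threshold keep the initial value \<open>0\<close> of the output array.\<close>

definition assign_parts :: com where
  "assign_parts =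
     Assign R_vertex (Const 0) ;;
     While (Less R_vertex R_n)
       (load_degree ;;
        Cond (Less R_degree R_threshold)
          Skip
          (Write A_part R_vertex R_half ;; advance_halves) ;;
        Assign R_vertex (Reg R_next))"

text \<open>The guard \<open>0 < n\<close> covers the empty graph, for which \<open>\<lfloor>t / 2\<rfloor> + 1\<close> would be wrong. At the end the
  halves belong to \<open>j = t + 1\<close>, so the upper half is the number \<open>\<lfloor>t / 2\<rfloor> + 1\<close> of parts.\<close>

definition max_two_transitive_partition :: com where
  "max_two_transitive_partition =
     Cond (Less R_vertex R_n)
       (Assign R_one (Const 1) ;;
        tally_degrees ;;
        find_threshold ;;
        skip_numbers ;;
        assign_parts ;;
        Assign R_n (Reg R_half_up))
       Skip"

section \<open>Correctness and running time of the program\<close>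

lemma card_less_Suc:
  "card {v. v < Suc m \<and> P v} = card {v. v < m \<and> P v} + (if P m then 1 else 0)"
proof -
  have "{v. v < Suc m \<and> P v} = (if P m then insert m {v. v < m \<and> P v} else {v. v < m \<and> P v})"
    by (auto simp: less_Suc_eq)
  then show ?thesis by simp
qed

text \<open>The program depends on the graph only through the degree sequence \<open>d\<close>, so its analysis needs no
  graph.\<close>

locale degree_offsets =
  fixes n :: nat and d off :: "nat \<Rightarrow> nat" and w :: nat
  assumes offsets: "v < n \<Longrightarrow> off (Suc v) - off v = d v"
    and off_less: "v \<le> n \<Longrightarrow> off v < w"
    and word_size: "n + 3 < w"
    and degree_less: "v < n \<Longrightarrow> d v < n"
begin

text \<open>The number of vertices before \<open>v\<close> that reach the threshold: for \<open>v < n\<close> this numbers the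
  vertices of the clique, and for \<open>v = n\<close> it is their total number.\<close>

definition rank :: "nat \<Rightarrow> nat \<Rightarrow> nat" where
  "rank t v = card {u. u < v \<and> t \<le> d u}"

definition is_threshold :: "nat \<Rightarrow> bool" where
  "is_threshold t \<longleftrightarrow> t \<le> Suc (rank t n) \<and> (\<forall>u>t. Suc (rank u n) < u)"

definition frame :: "state \<Rightarrow> bool" where
  "frame s \<longleftrightarrow> regs s R_n = n \<and> regs s R_one = 1 \<and> arrs s A_offset = off"

definition fresh :: "state \<Rightarrow> bool" where
  "fresh s \<longleftrightarrow> frame s \<and> regs s R_half = 0 \<and> regs s R_half_up = 0 \<and> arrs s A_part = (\<lambda>_. 0)"

definition tallied :: "nat \<Rightarrow> state \<Rightarrow> bool" where
  "tallied v s \<longleftrightarrow> (\<forall>k. arrs s A_tally k = card {u. u < v \<and> d u = k})"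

lemma card_below_le: "card {u. u < v \<and> P u} \<le> v"
  using card_mono[of "{..<v}" "{u. u < v \<and> P u}"] by auto

lemma rank_le: "rank t v \<le> v"
  unfolding rank_def by (rule card_below_le)

lemma rank_Suc: "rank t (Suc v) = rank t v + (if t \<le> d v then 1 else 0)"
  unfolding rank_def by (rule card_less_Suc)

lemma rank_pred:
  assumes "0 < t"
  shows "rank (t - 1) n = rank t n + card {u. u < n \<and> d u = t - 1}"
proof -
  have "{u. u < n \<and> t - 1 \<le> d u} = {u. u < n \<and> t \<le> d u} \<union> {u. u < n \<and> d u = t - 1}"
    using assms by auto
  moreover have "card \<dots> = card {u. u < n \<and> t \<le> d u} + card {u. u < n \<and> d u = t - 1}"
    using assms by (intro card_Un_disjoint) auto
  ultimately show ?thesis by (simp only: rank_def)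
qed

lemma rank_top:
  assumes "n \<le> t"
  shows "rank t n = 0"
proof -
  have "{u. u < n \<and> t \<le> d u} = {}" using degree_less assms by fastforce
  then show ?thesis by (simp only: rank_def card.empty)
qed

lemma wp_load_degree:
  assumes "frame s" and "regs s R_vertex = v" and "v < n"
  shows "wp w load_degree Q s \<longleftrightarrow>
    Q 4 (s\<lparr>regs := (regs s)(R_next := Suc v, R_temp := off v, R_degree := d v)\<rparr>)"
  using assms offsets[of v] off_less[of v] off_less[of "Suc v"] word_size degree_less[of v]
  by (simp add: load_degree_def wp_simps frame_def numeral_2_eq_2[symmetric])

lemma wp_tally_degrees:
  assumes "fresh s" and "regs s R_vertex = 0" and "tallied 0 s"
  shows "wp w tally_degrees (\<lambda>t s'. t \<le> 1 + n * 9 \<and> fresh s' \<and> tallied n s') s"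
  unfolding tally_degrees_def
proof (rule wp_While[where I = "\<lambda>s. fresh s \<and> regs s R_vertex \<le> n \<and> tallied (regs s R_vertex) s"
      and \<mu> = "\<lambda>s. n - regs s R_vertex" and B = 8], goal_cases)
  case 1
  show ?case using assms by simp
next
  case (2 s)
  let ?v = "regs s R_vertex"
  have f: "frame s" and v: "?v < n" using 2 by (auto simp: fresh_def frame_def)
  show ?case
    using 2 v word_size card_below_le[of ?v "\<lambda>u. d u = d ?v"]
    by (simp add: wp_simps wp_load_degree[OF f refl v] fresh_def frame_def tallied_def card_less_Suc)
next
  case (3 t s')
  then have "regs s' R_vertex = n" by (auto simp: fresh_def frame_def)
  then show ?case using 3 assms by simp
qed

lemma wp_find_threshold:
  assumes "fresh s" and "tallied n s" and "0 < n"
  shows "wp w find_threshold (\<lambda>t s'. t \<le> 3 + n * 4 \<and> fresh s' \<and>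
    is_threshold (regs s' R_threshold) \<and> regs s' R_threshold \<le> n \<and>
    regs s' R_count = Suc (rank (regs s' R_threshold) n)) s"
proof -
  have s: "regs s R_n = n" "Suc 0 < w" "n < w"
    using assms(1) word_size by (simp_all add: fresh_def frame_def)
  let ?I = "\<lambda>s. fresh s \<and> tallied n s \<and> regs s R_threshold \<le> n \<and>
    regs s R_count = Suc (rank (regs s R_threshold) n) \<and>
    (\<forall>u>regs s R_threshold. Suc (rank u n) < u)"
  let ?s = "s\<lparr>regs := (regs s)(R_count := Suc 0, R_threshold := n)\<rparr>"
  have I: "?I ?s"
    using assms s by (auto simp: rank_top fresh_def frame_def tallied_def)
  show ?thesis
    unfolding find_threshold_def
  proof (simp add: wp_simps s, rule wp_While[where I = ?I and \<mu> = "\<lambda>s. regs s R_threshold" and B = 3], goal_cases)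
    case 1
    show ?case by (rule I)
  next
    case (2 s)
    let ?t = "regs s R_threshold"
    have eqs: "regs s R_n = n" "regs s R_one = 1" "arrs s A_offset = off" "regs s R_half = 0"
        "regs s R_half_up = 0" "arrs s A_part = (\<lambda>_. 0)"
      and tally: "\<And>k. arrs s A_tally k = card {u. u < n \<and> d u = k}"
      and count: "regs s R_count = Suc (rank ?t n)" and above: "\<And>u. ?t < u \<Longrightarrow> Suc (rank u n) < u"
      and "?t \<le> n"
      using 2 by (simp_all add: fresh_def frame_def tallied_def)
    have t: "Suc (rank ?t n) < ?t" "0 < ?t" using 2 by auto
    have "Suc (rank u n) < u" if "?t - 1 < u" for u
      using above[of u] t that by (cases "u = ?t") auto
    moreover have "rank ?t n + card {u. u < n \<and> d u = ?t - 1} \<le> n"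
      using rank_pred[OF t(2)] rank_le[of "?t - 1" n] by simp
    moreover have "?t - 1 < w" "?t - 1 \<le> n" using \<open>?t \<le> n\<close> word_size by linarith+
    ultimately show ?case
      using t word_size rank_pred[OF t(2)]
      by (simp add: wp_simps fresh_def frame_def tallied_def eqs tally count)
  next
    case (3 t s')
    then show ?case using s by (simp add: is_threshold_def)
  qed
qed

lemma wp_skip_numbers:
  assumes "fresh s" and "regs s R_threshold = t" and "t \<le> n" and "regs s R_count = Suc (rank t n)"
  defines "r \<equiv> Suc t - rank t n"
  shows "wp w skip_numbers (\<lambda>T s'. T \<le> 3 + (t + 2) * 5 \<and> frame s' \<and> arrs s' A_part = (\<lambda>_. 0) \<and>
    regs s' R_threshold = t \<and> regs s' R_half = r div 2 \<and> regs s' R_half_up = Suc r div 2) s"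
proof -
  let ?c = "Suc (rank t n)"
  let ?I = "\<lambda>s. frame s \<and> arrs s A_part = (\<lambda>_. 0) \<and> regs s R_threshold = t \<and> regs s R_bound = t + 2 \<and>
    ?c \<le> regs s R_count \<and> regs s R_count \<le> max ?c (t + 2) \<and>
    regs s R_half = (regs s R_count - ?c) div 2 \<and> regs s R_half_up = Suc (regs s R_count - ?c) div 2"
  let ?s = "s\<lparr>regs := (regs s)(R_bound := Suc (Suc t))\<rparr>"
  have w: "2 < w" "Suc (Suc t) < w" using word_size assms(3) by simp_all
  have I: "?I ?s" using assms by (simp add: fresh_def frame_def)
  show ?thesis
    unfolding skip_numbers_def
  proof (simp add: wp_simps w assms(2), rule wp_While[where I = ?I and \<mu> = "\<lambda>s. regs s R_bound - regs s R_count" and B = 4], goal_cases)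
    case 1
    show ?case by (rule I)
  next
    case (2 s)
    define j where "j = regs s R_count - ?c"
    have eqs: "regs s R_n = n" "regs s R_one = 1" "arrs s A_offset = off" "arrs s A_part = (\<lambda>_. 0)"
        "regs s R_threshold = t" "regs s R_bound = t + 2" "regs s R_half = j div 2"
        "regs s R_half_up = Suc j div 2"
      and count: "regs s R_count = ?c + j" "?c + j < t + 2"
      using 2 by (simp_all add: frame_def j_def)
    have "Suc (j div 2) < w" "Suc j div 2 < w" using count(2) w by linarith+
    then show ?case
      using count(2) w
      by (simp add: wp_simps advance_halves_def frame_def eqs count(1))
  next
    case (3 T s')
    then have "regs s' R_count - ?c = r" unfolding r_def by auto
    then show ?case using 3 assms(2,4) by simp
  qed
qed

lemma wp_assign_parts:
  assumes "frame s" and "arrs s A_part = (\<lambda>_. 0)" and "regs s R_threshold = t" and "t \<le> n"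
    and "regs s R_half = r div 2" and "regs s R_half_up = Suc r div 2" and r: "r + rank t n \<le> n + 3"
  shows "wp w assign_parts (\<lambda>T s'. T \<le> 2 + n * 11 \<and> frame s' \<and>
    (\<forall>u<n. arrs s' A_part u = (if t \<le> d u then (r + rank t u) div 2 else 0)) \<and>
    regs s' R_half_up = Suc (r + rank t n) div 2) s"
proof -
  let ?part = "\<lambda>v u. if u < v \<and> t \<le> d u then (r + rank t u) div 2 else 0"
  let ?I = "\<lambda>s. frame s \<and> regs s R_threshold = t \<and> regs s R_vertex \<le> n \<and>
    arrs s A_part = ?part (regs s R_vertex) \<and>
    regs s R_half = (r + rank t (regs s R_vertex)) div 2 \<and>
    regs s R_half_up = Suc (r + rank t (regs s R_vertex)) div 2"
  let ?s = "s\<lparr>regs := (regs s)(R_vertex := 0)\<rparr>"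
  have w: "0 < w" using word_size by simp
  have I: "?I ?s" using assms by (simp add: frame_def rank_def)
  show ?thesis
    unfolding assign_parts_def
  proof (simp add: wp_simps w, rule wp_While[where I = ?I and \<mu> = "\<lambda>s. n - regs s R_vertex" and B = 10], goal_cases)
    case 1
    show ?case by (rule I)
  next
    case (2 s)
    define v where "v = regs s R_vertex"
    define j where "j = r + rank t v"
    have f: "frame s" and v: "v < n" using 2 by (auto simp: frame_def v_def)
    have eqs: "regs s R_n = n" "regs s R_one = 1" "arrs s A_offset = off"
        "regs s R_threshold = t" "regs s R_half = j div 2" "regs s R_half_up = Suc j div 2"
        "arrs s A_part = ?part v"
      using 2 by (simp_all add: frame_def j_def v_def)
    have "rank t v \<le> rank t n"
      unfolding rank_def using v by (intro card_mono) auto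
    then have "j \<le> n + 3" using r by (simp add: j_def)
    then have jw: "Suc (j div 2) < w" "Suc j div 2 < w" using word_size by linarith+
    have part_Suc: "?part (Suc v) = (?part v)(v := if t \<le> d v then j div 2 else 0)"
      by (auto simp: j_def less_Suc_eq)
    have j_Suc: "r + rank t (Suc v) = (if t \<le> d v then Suc j else j)"
      by (simp add: rank_Suc j_def)
    have part_v: "?part v v = 0" by simp
    show ?case
    proof (cases "t \<le> d v")
      case True
      show ?thesis
        using True v jw word_size
        by (simp add: wp_simps wp_load_degree[OF f v_def[symmetric] v] advance_halves_def frame_def
            eqs v_def[symmetric] part_Suc j_Suc)
    next
      case False
      have "(?part v)(v := 0) = ?part v" by auto
      then show ?thesis
        using False v jw word_size
        by (simp add: wp_simps wp_load_degree[OF f v_def[symmetric] v] frame_def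
            eqs v_def[symmetric] part_Suc j_Suc)
    qed
  next
    case (3 T s')
    then have "regs s' R_vertex = n" by (auto simp: frame_def)
    then show ?case using 3 by simp
  qed
qed

text \<open>The difference \<open>Suc t - rank t n\<close> is truncated here; that it is a true difference is a fact about
  split graphs and enters only in the final correctness proof.\<close>

lemma wp_max_two_transitive_partition:
  assumes "0 < n" and "regs s = (\<lambda>_. 0)(R_n := n)" and "arrs s A_offset = off"
    and "arrs s A_part = (\<lambda>_. 0)" and "arrs s A_tally = (\<lambda>_. 0)"
  shows "wp w max_two_transitive_partition (\<lambda>T s'. T \<le> 40 * (n + 1) \<and>
    (\<exists>t. is_threshold t \<and> regs s' R_n = Suc (Suc t - rank t n + rank t n) div 2 \<and>
      (\<forall>u<n. arrs s' A_part u = (if t \<le> d u then (Suc t - rank t n + rank t u) div 2 else 0)))) s"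
proof -
  have w: "Suc 0 < w" using word_size by simp
  let ?s = "s\<lparr>regs := (regs s)(R_one := Suc 0)\<rparr>"
  have "fresh ?s" "tallied 0 ?s" "regs ?s R_vertex = 0"
    using assms by (simp_all add: fresh_def frame_def tallied_def)
  note tally = wp_tally_degrees[OF this(1,3,2)]
  define Post where "Post s' \<longleftrightarrow>
      (\<exists>t. is_threshold t \<and> regs s' R_n = Suc (Suc t - rank t n + rank t n) div 2 \<and>
      (\<forall>u<n. arrs s' A_part u = (if t \<le> d u then (Suc t - rank t n + rank t u) div 2 else 0)))"
    for s' :: state
  have start: "regs s R_n = n" "regs s R_vertex = 0" using assms(2) by simp_all
  show ?thesis
    unfolding max_two_transitive_partition_def Post_def[symmetric]
  proof (simp add: wp_simps w start assms(1), rule wp_mono[OF tally], goal_cases)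
    case (1 T1 s1)
    then have "fresh s1" "tallied n s1" and T1: "T1 \<le> 1 + n * 9" by simp_all
    show ?case
      unfolding wp_Seq
    proof (rule wp_mono[OF wp_find_threshold[OF \<open>fresh s1\<close> \<open>tallied n s1\<close> \<open>0 < n\<close>]], goal_cases)
      case (1 T2 s2)
      define t where "t = regs s2 R_threshold"
      define r where "r = Suc t - rank t n"
      have T2: "T2 \<le> 3 + n * 4" and "fresh s2" and t: "is_threshold t" "t \<le> n"
        and "regs s2 R_count = Suc (rank t n)"
        using 1 by (simp_all add: t_def)
      note skip = wp_skip_numbers[OF \<open>fresh s2\<close> t_def[symmetric] t(2) this(5), folded r_def]
      show ?case
        unfolding wp_Seq
      proof (rule wp_mono[OF skip], goal_cases)
        case (1 T3 s3)
        then have T3: "T3 \<le> 3 + (t + 2) * 5" by simp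
        have r: "r + rank t n \<le> n + 3" using t(2) rank_le[of t n] by (auto simp: r_def)
        have "wp w assign_parts (\<lambda>T s'. T \<le> 2 + n * 11 \<and> frame s' \<and>
            (\<forall>u<n. arrs s' A_part u = (if t \<le> d u then (r + rank t u) div 2 else 0)) \<and>
            regs s' R_half_up = Suc (r + rank t n) div 2) s3"
          using 1 by (intro wp_assign_parts t(2) r) simp_all
        then show ?case
          unfolding wp_Seq
        proof (rule wp_mono, goal_cases)
          case (1 T4 s4)
          have "Suc (r + rank t n) div 2 < w" using r word_size by linarith
          moreover have "T4 \<le> 2 + n * 11" using 1 by simp
          then have "T1 + (T2 + (T3 + T4)) \<le> 37 + 40 * n"
            using T1 T2 T3 t(2) by simp
          ultimately show ?case
            using 1 t(1) by (auto simp: wp_Assign Post_def r_def intro!: exI[of _ t])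
        qed
      qed
    qed
  qed
qed
end

text \<open>Half of the handshake lemma. It bounds the offsets, which are sums of degrees, by the size of
  the graph, so that they fit into machine words.\<close>

lemma sum_degree_le:
  assumes "simple_graph V E"
  shows "(\<Sum>v\<in>V. degree E v) \<le> 2 * card E"
proof -
  have edges: "e \<subseteq> V" "card e = 2" if "e \<in> E" for e
    using assms that by (auto simp: simple_graph_def)
  have "finite V" using assms by (simp add: simple_graph_def)
  moreover have "E \<subseteq> Pow V" using edges by blast
  ultimately have "finite E" by (simp add: finite_subset)
  have "degree E v \<le> card {e \<in> E. v \<in> e}" for v
    unfolding degree_def
  proof (rule card_inj_on_le)
    show "inj_on (\<lambda>u. {u, v}) {u. {u, v} \<in> E}" by (auto simp: inj_on_def doubleton_eq_iff)
  qed (use \<open>finite E\<close> in auto)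
  then have "(\<Sum>v\<in>V. degree E v) \<le> (\<Sum>v\<in>V. card {e \<in> E. v \<in> e})" by (rule sum_mono)
  also have "\<dots> = 2 * card E"
  proof (rule sum_multicount[OF \<open>finite V\<close> \<open>finite E\<close>], intro ballI)
    fix e assume "e \<in> E"
    then have "{v \<in> V. v \<in> e} = e" using edges by blast
    then show "card {v \<in> V. v \<in> e} = 2" using edges \<open>e \<in> E\<close> by simp
  qed
  finally show ?thesis .
qed

lemma degree_adjacency_lists:
  assumes "adjacency_lists adj V E" and "v < length adj"
  shows "length (adj ! v) = degree E v"
proof -
  have "distinct (adj ! v)" "set (adj ! v) = {u. {u, v} \<in> E}"
    using assms by (simp_all add: adjacency_lists_def)
  then show ?thesis by (metis degree_def distinct_card)
qed

lemma Tr2_empty: "Tr2 {} E = 0" and two_transitive_partition_empty: "two_transitive_partition {} E []"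
proof -
  obtain Ps where "two_transitive_partition {} E Ps" "length Ps = Tr2 {} E"
    using Tr2_attained[of "{}" E] by auto
  then show "Tr2 {} E = 0" by (auto simp: two_transitive_partition_def partition_on_empty)
qed (simp add: two_transitive_partition_def partition_on_empty)

text \<open>The four phases take at most \<open>9 n + 1\<close>, \<open>4 n + 3\<close>, \<open>5 (n + 2) + 3\<close> and \<open>11 n + 2\<close> time units, whence
  the factor \<open>40\<close>. It is also ample for the word size: the largest values are offsets, which are at
  most \<open>2 |E|\<close>, and numbers up to \<open>n + 2\<close>.\<close>

lemma max_two_transitive_partition_correct:
  assumes split: "split_graph V E" and adj: "adjacency_lists adj V E"
  shows "wp (40 * (card V + card E + 1)) max_two_transitive_partition
    (\<lambda>t s. t \<le> 40 * (card V + card E + 1) \<and>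
      two_transitive_partition V E (output_parts V s) \<and> length (output_parts V s) = Tr2 V E)
    (input_state adj)"
proof (cases "adj = []")
  case True
  then have "V = {}" using adj by (simp add: adjacency_lists_def)
  then show ?thesis
    using True by (simp add: max_two_transitive_partition_def wp_simps input_state_def
        output_parts_def Tr2_empty two_transitive_partition_empty)
next
  case False
  define n where "n = length adj"
  define off where "off = arrs (input_state adj) A_offset"
  let ?w = "40 * (card V + card E + 1)"
  have V: "V = {..<n}" using adj by (simp add: adjacency_lists_def n_def)
  obtain S K where "split_partition V E S K" using split by (auto simp: split_graph_iff)
  then interpret split_partition V E S K .
  have off: "off v = sum_list (map length (take v adj))" if "v \<le> n" for v
    using that by (simp add: off_def input_state_def n_def)
  have total: "sum_list (map length adj) \<le> 2 * card E"
  proof -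
    have "sum_list (map length adj) = (\<Sum>v<n. degree E v)"
      using degree_adjacency_lists[OF adj]
      by (simp add: sum_list_sum_nth n_def atLeast0LessThan)
    then show ?thesis using sum_degree_le[OF simple] by (simp add: V)
  qed
  interpret degree_offsets n "degree E" off ?w
  proof
    fix v assume v: "v < n"
    then show "off (Suc v) - off v = degree E v"
      using degree_adjacency_lists[OF adj] by (simp add: off take_Suc_conv_app_nth n_def)
    have "{u. {u, v} \<in> E} \<subset> V" using edgeD v V by blast
    then show "degree E v < n"
      using psubset_card_mono[OF finite_vertices(1)] by (simp add: degree_def V)
  next
    fix v assume "v \<le> n"
    moreover have "sum_list (map length (take v adj)) \<le> sum_list (map length adj)"
      by (metis append_take_drop_id le_add1 map_append sum_list_append)
    ultimately show "off v < ?w" using total by (simp add: off)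
  qed (simp add: V)
  have high: "high_degree V E t = {u. u < n \<and> t \<le> degree E u}" for t
    by (auto simp: high_degree_def V)
  have rank_n: "rank t n = card (high_degree V E t)" for t by (simp add: rank_def high)
  have "0 < n" using False by (simp add: n_def)
  moreover have "regs (input_state adj) = (\<lambda>_. 0)(R_n := n)"
      "arrs (input_state adj) A_part = (\<lambda>_. 0)" "arrs (input_state adj) A_tally = (\<lambda>_. 0)"
    by (simp_all add: input_state_def n_def)
  ultimately show ?thesis
  proof (rule wp_mono[OF wp_max_two_transitive_partition[OF _ _ off_def[symmetric]]], goal_cases)
    case (1 T s)
    then obtain t where t: "is_threshold t"
      and s: "regs s R_n = Suc (Suc t - rank t n + rank t n) div 2"
        "\<And>u. u < n \<Longrightarrow> arrs s A_part u =
          (if t \<le> degree E u then (Suc t - rank t n + rank t u) div 2 else 0)"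
      and T: "T \<le> 40 * (n + 1)" by auto
    have thr: "degree_threshold V E t"
      using t by (simp add: is_threshold_def degree_threshold_def rank_n)
    have "V \<noteq> {}" using \<open>0 < n\<close> V by auto
    note parts = Tr2_split_graph[OF split thr this]
    have "rank t n \<le> Suc t"
      using split_partition_high_degree(2)[OF split thr] by (simp add: rank_n)
    then have n_parts: "regs s R_n = Suc (t div 2)" by (simp add: s(1))
    have rank_v: "rank t v = card {u \<in> high_degree V E t. u < v}" if "v \<in> V" for v
    proof -
      have "v < n" using that V by simp
      then show ?thesis by (simp add: rank_def high) (metis order.strict_trans)
    qed
    have "arrs s A_part v = (if v \<in> high_degree V E t
        then (Suc t - card (high_degree V E t) + card {u \<in> high_degree V E t. u < v}) div 2 else 0)"
      if "v \<in> V" for v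
    proof -
      have "v < n" using that V by simp
      then show ?thesis
        unfolding s(2)[OF \<open>v < n\<close>] rank_v[OF that] rank_n using that by (simp add: high_degree_def)
    qed
    then have "output_parts V s = map (\<lambda>i. {v \<in> V. (if v \<in> high_degree V E t
        then (Suc t - card (high_degree V E t) + card {u \<in> high_degree V E t. u < v}) div 2 else 0) = i})
          [0..<Suc (t div 2)]"
      unfolding output_parts_def n_parts by (intro map_cong refl Collect_cong) auto
    then show ?case using parts T by (simp add: V)
  qed
qed

theorem theorem24:
  shows "\<exists>(p :: com) (c :: nat). \<forall>(V :: nat set) (E :: nat set set) (adj :: nat list list).
    split_graph V E \<longrightarrow> adjacency_lists adj V E \<longrightarrow>
    (\<exists>t s. exec (c * (card V + card E + 1)) p (input_state adj) t s \<and>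
           t \<le> c * (card V + card E + 1) \<and>
           two_transitive_partition V E (output_parts V s) \<and>
           length (output_parts V s) = Tr2 V E)"
  using max_two_transitive_partition_correct unfolding wp_def by blast

end
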